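(* Every left duo, l.f.g.u. monoid satisfies the ACCP.
   Context: Let $H$ be a (multiplicatively written) monoid with identity $1_H$. $H$ is left duo if $aH \subseteq Ha$ for all $a \in H$. $H$ satisfies the ACCP (ascending chain condition on principal two-sided ideals) if there is no infinite sequence $x_1, x_2, \ldots$ of elements of $H$ such that $Hx_iH \subsetneq Hx_{i+1}H$ for each $i \ge 1$. For $x,y \in H$ write $x \mid_H y$ if $y \in HxH$. A $\mid_H$-unit is an element $u \in H$ with $u \mid_H 1_H$ (and hence $1_H \mid_H u \mid_H 1_H$); other elements are $\mid_H$-non-units. A submonoid $K$ of $H$ is divisor-closed if $x \mid_H y$ and $y \in K$ imply $x \in K$; $[\![x]\!]_H$ is the smallest divisor-closed submonoid of $H$ containing $x$. $H$ is l.f.g.u. (locally finitely generated up to units) if, for every $\mid_H$-non-unit $x$, there is a finite set $A \subseteq [\![x]\!]_H$ such that $[\![x]\!]_H$ is generated as a monoid by $UAU$, where $U$ is the set of $\mid_H$-units of $H$ lying in $[\![x]\!]_H$. *)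

theory Defs
  imports "HOL-Algebra.Coset"
begin

definition left_duo :: "('a, 'b) monoid_scheme \<Rightarrow> bool"
  where "left_duo H \<longleftrightarrow> (\<forall>a\<in>carrier H. a <#\<^bsub>H\<^esub> carrier H \<subseteq> carrier H #>\<^bsub>H\<^esub> a)"

definition two_sided_ideal :: "('a, 'b) monoid_scheme \<Rightarrow> 'a \<Rightarrow> 'a set"
  where "two_sided_ideal H x = carrier H <#>\<^bsub>H\<^esub> {x} <#>\<^bsub>H\<^esub> carrier H"

definition accp :: "('a, 'b) monoid_scheme \<Rightarrow> bool"
  where "accp H \<longleftrightarrow>
    \<not> (\<exists>x :: nat \<Rightarrow> 'a. (\<forall>i. x i \<in> carrier H) \<and>
          (\<forall>i. two_sided_ideal H (x i) \<subset> two_sided_ideal H (x (Suc i))))"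

text \<open>Unlike \<open>factor\<close> of HOL-Algebra, whose cofactor stands on one side only, this relation
  allows cofactors on both sides.\<close>

definition divides2 :: "('a, 'b) monoid_scheme \<Rightarrow> 'a \<Rightarrow> 'a \<Rightarrow> bool"
  where "divides2 H x y \<longleftrightarrow> x \<in> carrier H \<and> y \<in> two_sided_ideal H x"

text \<open>Without further hypotheses on the monoid, this set may be larger than \<open>Units H\<close>.\<close>

definition div_units :: "('a, 'b) monoid_scheme \<Rightarrow> 'a set"
  where "div_units H = {u \<in> carrier H. divides2 H u \<one>\<^bsub>H\<^esub>}"

definition divisor_closed :: "'a set \<Rightarrow> ('a, 'b) monoid_scheme \<Rightarrow> bool"
  where "divisor_closed K H \<longleftrightarrow>
    submonoid K H \<and> (\<forall>x y. divides2 H x y \<longrightarrow> y \<in> K \<longrightarrow> x \<in> K)"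

definition div_hull :: "('a, 'b) monoid_scheme \<Rightarrow> 'a \<Rightarrow> 'a set"
  where "div_hull H x = \<Inter>{K. divisor_closed K H \<and> x \<in> K}"

text \<open>The monoid counterpart of \<open>generate\<close>, which also closes under inverses.\<close>

inductive_set monoid_generate :: "('a, 'b) monoid_scheme \<Rightarrow> 'a set \<Rightarrow> 'a set"
  for H and S where
  one: "\<one>\<^bsub>H\<^esub> \<in> monoid_generate H S"
| incl: "s \<in> S \<Longrightarrow> s \<in> monoid_generate H S"
| mult: "a \<in> monoid_generate H S \<Longrightarrow> b \<in> monoid_generate H S
    \<Longrightarrow> a \<otimes>\<^bsub>H\<^esub> b \<in> monoid_generate H S"

definition lfgu :: "('a, 'b) monoid_scheme \<Rightarrow> bool"
  where "lfgu H \<longleftrightarrow>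
    (\<forall>x \<in> carrier H - div_units H. \<exists>A. finite A \<and> A \<subseteq> div_hull H x \<and>
       (let U = div_units H \<inter> div_hull H x
        in div_hull H x = monoid_generate H (U <#>\<^bsub>H\<^esub> A <#>\<^bsub>H\<^esub> U)))"

lemma divides2_iff:
  "divides2 H x y \<longleftrightarrow>
    x \<in> carrier H \<and> (\<exists>a\<in>carrier H. \<exists>b\<in>carrier H. y = a \<otimes>\<^bsub>H\<^esub> x \<otimes>\<^bsub>H\<^esub> b)"
  by (auto simp: divides2_def two_sided_ideal_def set_mult_def)

lemma divisor_closed_carrier:
  assumes "monoid H"
  shows "divisor_closed (carrier H) H"
proof -
  interpret monoid H by fact
  show ?thesis by (auto simp: divisor_closed_def divides2_def intro: submonoid.intro)
qed

lemma div_hull_divisor_closed: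
  assumes "monoid H" and "x \<in> carrier H"
  shows "divisor_closed (div_hull H x) H" and "x \<in> div_hull H x"
proof -
  have "div_hull H x \<subseteq> carrier H"
    using divisor_closed_carrier[OF assms(1)] assms(2) by (auto simp: div_hull_def)
  moreover have "a \<otimes>\<^bsub>H\<^esub> b \<in> div_hull H x" if "a \<in> div_hull H x" "b \<in> div_hull H x" for a b
    using that by (auto simp: div_hull_def divisor_closed_def intro: submonoid.m_closed)
  moreover have "\<one>\<^bsub>H\<^esub> \<in> div_hull H x"
    by (auto simp: div_hull_def divisor_closed_def intro: submonoid.one_closed)
  ultimately have "submonoid (div_hull H x) H" by (simp add: submonoid.intro)
  moreover have "a \<in> div_hull H x" if "divides2 H a b" "b \<in> div_hull H x" for a b
    using that unfolding div_hull_def divisor_closed_def by blast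
  ultimately show "divisor_closed (div_hull H x) H" unfolding divisor_closed_def by blast
qed (simp add: div_hull_def)

end

theory Submission
  imports Defs
begin

text \<open>
  Let \<open>K\<close> be the divisor-closed submonoid generated by the first term of an ascending chain of
  principal ideals. It contains the whole chain, is again left duo, and is generated by \<open>UAU\<close> with
  \<open>A\<close> finite. All left ideals of \<open>K\<close> are finitely generated: as in Cohen's theorem for commutative
  rings, a maximal counterexample would be a prime ideal, and a proper prime ideal of \<open>K\<close> is
  generated by the elements of \<open>A\<close> it contains. Hence the chain is stationary.
\<close>

section \<open>Left ideals and the left duo property\<close>

definition left_ideal :: "'a set \<Rightarrow> ('a, 'b) monoid_scheme \<Rightarrow> bool"
  where "left_ideal I H \<longleftrightarrow> I \<subseteq> carrier H \<and> carrier H <#>\<^bsub>H\<^esub> I \<subseteq> I"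

definition fin_gen_left_ideal :: "'a set \<Rightarrow> ('a, 'b) monoid_scheme \<Rightarrow> bool"
  where "fin_gen_left_ideal I H \<longleftrightarrow> (\<exists>F. finite F \<and> F \<subseteq> I \<and> I \<subseteq> carrier H <#>\<^bsub>H\<^esub> F)"

lemma left_ideal_mult: "left_ideal I H \<Longrightarrow> h \<in> carrier H \<Longrightarrow> x \<in> I \<Longrightarrow> h \<otimes>\<^bsub>H\<^esub> x \<in> I"
  unfolding left_ideal_def set_mult_def by blast

lemma left_duoE:
  assumes "left_duo H" "a \<in> carrier H" "b \<in> carrier H"
  obtains h where "h \<in> carrier H" "a \<otimes>\<^bsub>H\<^esub> b = h \<otimes>\<^bsub>H\<^esub> a"
  using assms unfolding left_duo_def l_coset_def r_coset_def by blast

text \<open>Left duo trades the right factor \<open>h\<close> for a left factor of \<open>x\<close>,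
  so left ideals are automatically two-sided.\<close>

lemma left_duo_left_ideal_mult_right:
  assumes "left_duo H" "left_ideal I H" "x \<in> I" "h \<in> carrier H"
  shows "x \<otimes>\<^bsub>H\<^esub> h \<in> I"
proof -
  have "x \<in> carrier H" using assms by (auto simp: left_ideal_def)
  then obtain k where "k \<in> carrier H" "x \<otimes>\<^bsub>H\<^esub> h = k \<otimes>\<^bsub>H\<^esub> x"
    using left_duoE[OF assms(1) _ assms(4)] by metis
  then show ?thesis using assms left_ideal_mult by metis
qed

text \<open>The rules of \<open>monoid_generate\<close> refer to the unit and the product but never
  to the carrier. This transfers the generation statement of \<open>lfgu\<close> from
  \<open>H\<close> to its submonoid \<open>K\<close>.\<close>

lemma monoid_generate_carrier_update:
  "monoid_generate (H\<lparr>carrier := K\<rparr>) S = monoid_generate H S"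
proof (intro subset_antisym subsetI)
  fix x
  show "x \<in> monoid_generate H S" if "x \<in> monoid_generate (H\<lparr>carrier := K\<rparr>) S"
    using that by induction (auto intro: monoid_generate.intros)
  show "x \<in> monoid_generate (H\<lparr>carrier := K\<rparr>) S" if "x \<in> monoid_generate H S"
    using that
  proof induction
    case one show ?case using monoid_generate.one[of "H\<lparr>carrier := K\<rparr>"] by simp
  next
    case (mult a b) then show ?case
      using monoid_generate.mult[of a "H\<lparr>carrier := K\<rparr>" S b] by simp
  qed (rule monoid_generate.incl)
qed

context monoid
begin

section \<open>Finite generation of left ideals by Cohen's argument\<close>

lemma fin_gen_left_ideal_if_one_mem:
  assumes "left_ideal I G" "\<one> \<in> I"
  shows "fin_gen_left_ideal I G"
  unfolding fin_gen_left_ideal_def using assms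
  by (intro exI[of _ "{\<one>}"]) (auto simp: left_ideal_def set_mult_def)

text \<open>If neither factor lay in \<open>P\<close>, both the enlargement of \<open>P\<close> by
  \<open>b\<close> and the colon ideal of \<open>P\<close> by \<open>b\<close> would properly
  contain \<open>P\<close>, hence be finitely generated by maximality. Their generators combine to
  finitely many generators of \<open>P\<close>.\<close>

lemma maximal_not_fin_gen_left_ideal_prime:
  assumes duo: "left_duo G" and P: "left_ideal P G" "\<not> fin_gen_left_ideal P G"
    and max: "\<And>J. left_ideal J G \<Longrightarrow> P \<subset> J \<Longrightarrow> fin_gen_left_ideal J G"
    and ab: "a \<in> carrier G" "b \<in> carrier G" "a \<otimes> b \<in> P"
  shows "a \<in> P \<or> b \<in> P"
proof (rule ccontr)
  assume notin: "\<not> (a \<in> P \<or> b \<in> P)"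
  have Pc: "P \<subseteq> carrier G" using P by (simp add: left_ideal_def)
  \<comment> \<open>With no addition at hand, a union takes the place of the ideal sum in Cohen's
    proof.\<close>
  define J where "J = P \<union> (carrier G <#> {b})"
  define Q where "Q = {x \<in> carrier G. x \<otimes> b \<in> P}"
  have J: "x \<in> J \<longleftrightarrow> x \<in> P \<or> (\<exists>h\<in>carrier G. x = h \<otimes> b)" for x
    by (auto simp: J_def set_mult_def)
  have "h \<otimes> x \<in> J" if h: "h \<in> carrier G" and x: "x \<in> J" for h x
    using J h ab(2) left_ideal_mult[OF P(1) h] x by (metis m_assoc m_closed)
  moreover have "J \<subseteq> carrier G" using Pc ab(2) J by auto
  ultimately have "left_ideal J G" by (auto simp: left_ideal_def set_mult_def)
  moreover have "b \<in> J" using J ab(2) l_one one_closed by metis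
  moreover have "P \<subseteq> J" using J by blast
  ultimately obtain F where F: "finite F" "F \<subseteq> J" "J \<subseteq> carrier G <#> F"
    using max notin unfolding fin_gen_left_ideal_def by (metis psubsetI)
  have "left_ideal Q G"
    using ab left_ideal_mult[OF P(1)] by (auto simp: left_ideal_def Q_def set_mult_def m_assoc)
  \<comment> \<open>Here \<open>P\<close> has to absorb the right factor \<open>b\<close>, which is
    where left duo enters.\<close>
  moreover have "P \<subseteq> Q"
    using Pc left_duo_left_ideal_mult_right[OF duo P(1)] ab by (auto simp: Q_def)
  moreover have "a \<in> Q" using ab by (simp add: Q_def)
  ultimately obtain E where E: "finite E" "E \<subseteq> Q" "Q \<subseteq> carrier G <#> E"
    using max notin unfolding fin_gen_left_ideal_def by (metis psubsetI)
  \<comment> \<open>A generator of \<open>J\<close> outside \<open>P\<close> has the form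
    \<open>k \<otimes> b\<close>. If \<open>h \<otimes> (k \<otimes> b)\<close> is in
    \<open>P\<close>, then \<open>h \<otimes> k\<close> is in \<open>Q\<close>, so \<open>E\<close>
    multiplied by \<open>b\<close> accounts for it.\<close>
  let ?F = "(F \<inter> P) \<union> (\<lambda>q. q \<otimes> b) ` E"
  have "P \<subseteq> carrier G <#> ?F"
  proof
    fix p assume p: "p \<in> P"
    then obtain h f where hf: "h \<in> carrier G" "f \<in> F" "p = h \<otimes> f"
      using F(3) by (auto simp: J_def set_mult_def)
    show "p \<in> carrier G <#> ?F"
    proof (cases "f \<in> P")
      case True then show ?thesis using hf by (auto simp: set_mult_def)
    next
      case False
      then obtain k where k: "k \<in> carrier G" "f = k \<otimes> b"
        using F(2) hf by (auto simp: J_def set_mult_def)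
      then have "h \<otimes> k \<in> Q" using p hf ab by (simp add: Q_def m_assoc)
      then obtain c q where cq: "c \<in> carrier G" "q \<in> E" "h \<otimes> k = c \<otimes> q"
        using E(3) by (auto simp: set_mult_def)
      have "q \<in> carrier G" using cq E(2) by (auto simp: Q_def)
      then have "p = c \<otimes> (q \<otimes> b)" using cq hf k ab by (metis m_assoc)
      then show ?thesis using cq by (auto simp: set_mult_def)
    qed
  qed
  moreover have "finite ?F" "?F \<subseteq> P" using F E by (auto simp: Q_def)
  ultimately show False using P(2) unfolding fin_gen_left_ideal_def by blast
qed

text \<open>A finite generating set of the union already lies in one member of the chain and would
  generate that member. This is the chain condition for Zorn's lemma.\<close>

lemma not_fin_gen_left_ideal_Union:
  assumes chain: "subset.chain {I. left_ideal I G \<and> \<not> fin_gen_left_ideal I G} C"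
    and "C \<noteq> {}"
  shows "left_ideal (\<Union>C) G" "\<not> fin_gen_left_ideal (\<Union>C) G"
proof -
  have C: "left_ideal I G" "\<not> fin_gen_left_ideal I G" if "I \<in> C" for I
    using chain that by (auto simp: subset.chain_def)
  show "left_ideal (\<Union>C) G"
    using C(1) unfolding left_ideal_def set_mult_def by blast
  show "\<not> fin_gen_left_ideal (\<Union>C) G"
  proof
    assume "fin_gen_left_ideal (\<Union>C) G"
    then obtain F where F: "finite F" "F \<subseteq> \<Union>C" "\<Union>C \<subseteq> carrier G <#> F"
      by (auto simp: fin_gen_left_ideal_def)
    obtain I where "I \<in> C" "F \<subseteq> I"
      using finite_subset_Union_chain[OF F(1,2) \<open>C \<noteq> {}\<close> chain] by blast
    then show False using C(2) F unfolding fin_gen_left_ideal_def by blast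
  qed
qed

theorem left_duo_fin_gen_left_ideal:
  assumes duo: "left_duo G"
    and A: "finite A" "A \<subseteq> carrier G" and U: "U \<subseteq> div_units G"
    and gen: "carrier G = monoid_generate G (U <#> A <#> U)"
    and I: "left_ideal I G"
  shows "fin_gen_left_ideal I G"
proof (rule ccontr)
  let ?N = "{I. left_ideal I G \<and> \<not> fin_gen_left_ideal I G}"
  assume "\<not> fin_gen_left_ideal I G"
  then have "?N \<noteq> {}" using I by blast
  moreover have "\<Union>C \<in> ?N" if "C \<noteq> {}" "subset.chain ?N C" for C
    using not_fin_gen_left_ideal_Union[OF that(2,1)] by simp
  ultimately obtain P where PN: "P \<in> ?N" and max: "\<forall>J\<in>?N. P \<subseteq> J \<longrightarrow> J = P"
    using subset_Zorn_nonempty[of ?N] by blast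
  then have P: "left_ideal P G" "\<not> fin_gen_left_ideal P G" by auto
  have prime: "a \<in> P \<or> b \<in> P" if "a \<in> carrier G" "b \<in> carrier G" "a \<otimes> b \<in> P" for a b
    using maximal_not_fin_gen_left_ideal_prime[OF duo P _ that] max by blast
  have one: "\<one> \<notin> P" using fin_gen_left_ideal_if_one_mem P by blast
  \<comment> \<open>As \<open>P\<close> is two-sided, \<open>u\<close> in \<open>P\<close> would put
    \<open>\<one> = a \<otimes> u \<otimes> b\<close> into \<open>P\<close>.\<close>
  have unit: "u \<in> carrier G \<and> u \<notin> P" if "u \<in> U" for u
  proof -
    have "divides2 G u \<one>" using that U by (auto simp: div_units_def)
    then obtain a b where "u \<in> carrier G" "a \<in> carrier G" "b \<in> carrier G" "\<one> = a \<otimes> u \<otimes> b"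
      by (auto simp: divides2_iff)
    then show ?thesis
      using one left_duo_left_ideal_mult_right[OF duo P(1)] left_ideal_mult[OF P(1)] by metis
  qed
  \<comment> \<open>Membership in \<open>P\<close> stays a premise of the induction: for a product,
    primeness tells which factor satisfies it, and only that factor needs the induction
    hypothesis.\<close>
  have "x \<in> carrier G <#> (A \<inter> P)" if "x \<in> monoid_generate G (U <#> A <#> U)" "x \<in> P" for x
    using that
  proof (induction)
    case one then show ?case using \<open>\<one> \<notin> P\<close> by simp
  next
    case (incl s)
    then obtain u a v where s: "u \<in> U" "a \<in> A" "v \<in> U" "s = u \<otimes> a \<otimes> v"
      by (auto simp: set_mult_def)
    then have c: "u \<in> carrier G" "a \<in> carrier G" "v \<in> carrier G" using unit A by auto
    then have "a \<in> P" using s incl.prems prime[of "u \<otimes> a" v] prime[of u a] unit by auto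
    \<comment> \<open>Left duo moves the unit \<open>v\<close> to the left of \<open>a\<close>,
      exhibiting \<open>s\<close> as a left multiple of \<open>a\<close>.\<close>
    moreover obtain h where "h \<in> carrier G" "a \<otimes> v = h \<otimes> a" using left_duoE[OF duo c(2,3)] .
    then have "s = (u \<otimes> h) \<otimes> a" "u \<otimes> h \<in> carrier G" using s c by (simp_all add: m_assoc)
    ultimately show ?case using s by (auto simp: set_mult_def)
  next
    case (mult a b)
    have c: "a \<in> carrier G" "b \<in> carrier G" using mult.hyps gen by auto
    have ideal: "left_ideal (carrier G <#> (A \<inter> P)) G"
      using A by (fastforce simp: left_ideal_def set_mult_def m_assoc[symmetric])
    show ?case
      using prime[OF c mult.prems] mult.IH c
        left_ideal_mult[OF ideal] left_duo_left_ideal_mult_right[OF duo ideal] by blast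
  qed
  then have "P \<subseteq> carrier G <#> (A \<inter> P)" using P(1) gen by (auto simp: left_ideal_def)
  then show False using P(2) A(1) unfolding fin_gen_left_ideal_def by blast
qed

section \<open>Two-sided divisibility and divisor-closed submonoids\<close>

lemma divides2_trans: "divides2 G x y \<Longrightarrow> divides2 G y z \<Longrightarrow> divides2 G x z"
  unfolding divides2_iff by (metis m_assoc m_closed)

lemma divides2_refl: "x \<in> carrier G \<Longrightarrow> divides2 G x x"
  unfolding divides2_iff by (metis l_one r_one one_closed)

lemma divides2_iff_two_sided_ideal_subset:
  assumes "x \<in> carrier G" "y \<in> carrier G"
  shows "divides2 G x y \<longleftrightarrow> two_sided_ideal G y \<subseteq> two_sided_ideal G x"
  using assms divides2_trans divides2_refl unfolding divides2_def by blast

lemma divides2_mult: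
  assumes "a \<in> carrier G" "b \<in> carrier G"
  shows "divides2 G a (a \<otimes> b)" "divides2 G b (a \<otimes> b)"
  using assms unfolding divides2_iff by (metis l_one r_one one_closed m_closed)+

text \<open>The cofactor \<open>h\<close> in \<open>a \<otimes> b = h \<otimes> a\<close> divides
  \<open>a \<otimes> b\<close>, an element of \<open>K\<close>, so it lies in \<open>K\<close>
  itself.\<close>

lemma divisor_closed_left_duo:
  assumes "left_duo G" "divisor_closed K G"
  shows "left_duo (G\<lparr>carrier := K\<rparr>)"
proof -
  interpret K: submonoid K G using assms by (simp add: divisor_closed_def)
  have "\<exists>h\<in>K. a \<otimes> b = h \<otimes> a" if ab: "a \<in> K" "b \<in> K" for a b
  proof -
    have c: "a \<in> carrier G" "b \<in> carrier G" using K.subset ab by auto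
    obtain h where h: "h \<in> carrier G" "a \<otimes> b = h \<otimes> a" using left_duoE[OF assms(1) c] .
    then have "divides2 G h (a \<otimes> b)" using divides2_mult(1) c by simp
    then show ?thesis using assms(2) h K.m_closed[OF ab] unfolding divisor_closed_def by blast
  qed
  then show ?thesis by (auto simp: left_duo_def l_coset_def r_coset_def)
qed

text \<open>Both cofactors in \<open>\<one> = a \<otimes> u \<otimes> b\<close> divide
  \<open>\<one>\<close>, so \<open>K\<close> contains them.\<close>

lemma divisor_closed_div_units:
  assumes "divisor_closed K G"
  shows "div_units G \<inter> K \<subseteq> div_units (G\<lparr>carrier := K\<rparr>)"
proof
  interpret K: submonoid K G using assms by (simp add: divisor_closed_def)
  fix u assume u: "u \<in> div_units G \<inter> K"
  then obtain a b where ab: "u \<in> carrier G" "a \<in> carrier G" "b \<in> carrier G" "\<one> = a \<otimes> u \<otimes> b"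
    by (auto simp: div_units_def divides2_iff)
  then have "divides2 G a \<one>" "divides2 G b \<one>"
    using divides2_mult[of a "u \<otimes> b"] divides2_mult[of "a \<otimes> u" b] by (simp_all add: m_assoc)
  then have "a \<in> K" "b \<in> K" using assms K.one_closed unfolding divisor_closed_def by blast+
  then show "u \<in> div_units (G\<lparr>carrier := K\<rparr>)"
    using u ab(4) by (auto simp: div_units_def divides2_iff)
qed

end

theorem theorem5p8:
  fixes H :: "('a, 'b) monoid_scheme"
  assumes "monoid H"
    and "left_duo H"
    and "lfgu H"
  shows "accp H"
  unfolding accp_def
proof
  interpret monoid H by fact
  assume "\<exists>x :: nat \<Rightarrow> 'a. (\<forall>i. x i \<in> carrier H) \<and>
          (\<forall>i. two_sided_ideal H (x i) \<subset> two_sided_ideal H (x (Suc i)))"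
  then obtain x :: "nat \<Rightarrow> 'a" where x: "\<And>i. x i \<in> carrier H"
    and strict: "\<And>i. two_sided_ideal H (x i) \<subset> two_sided_ideal H (x (Suc i))" by blast
  \<comment> \<open>Larger ideals belong to divisors: later terms divide earlier ones, and all of
    them divide \<open>x 0\<close>.\<close>
  have chain: "divides2 H (x j) (x i)" if "i \<le> j" for i j
    using lift_Suc_mono_le[of "\<lambda>i. two_sided_ideal H (x i)", OF _ that] strict x
    by (simp add: divides2_iff_two_sided_ideal_subset psubset_imp_subset)
  have strict': "\<not> divides2 H (x i) (x (Suc i))" for i
    using strict x by (auto simp: divides2_iff_two_sided_ideal_subset)
  define K where "K = div_hull H (x 0)"
  define M where "M = H\<lparr>carrier := K\<rparr>"
  have K: "divisor_closed K H" "x 0 \<in> K"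
    unfolding K_def using div_hull_divisor_closed[OF \<open>monoid H\<close> x] by auto
  interpret K: submonoid K H using K by (simp add: divisor_closed_def)
  interpret M: monoid M unfolding M_def by (rule K.submonoid_is_monoid[OF \<open>monoid H\<close>])
  have xK: "x i \<in> K" for i
    using chain[of 0 i] K unfolding divisor_closed_def by blast
  \<comment> \<open>\<open>lfgu\<close> speaks of non-units only. A unit \<open>x 0\<close> would
    divide every element, in particular \<open>x 1\<close>.\<close>
  have "x 0 \<notin> div_units H"
  proof
    assume "x 0 \<in> div_units H"
    then have "divides2 H (x 0) \<one>\<^bsub>H\<^esub>" by (simp add: div_units_def)
    moreover have "divides2 H \<one>\<^bsub>H\<^esub> (x 1)" using divides2_mult(1)[of "\<one>\<^bsub>H\<^esub>" "x 1"] x by simp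
    ultimately show False using divides2_trans strict'[of 0] by auto
  qed
  then obtain A where A: "finite A" "A \<subseteq> K"
    and gen: "K = monoid_generate H ((div_units H \<inter> K) <#>\<^bsub>H\<^esub> A <#>\<^bsub>H\<^esub> (div_units H \<inter> K))"
    using assms(3) x[of 0] unfolding lfgu_def K_def Let_def by blast
  \<comment> \<open>The trace on \<open>K\<close> of the union of the ascending chain of
    ideals.\<close>
  define I where "I = {y \<in> K. \<exists>i. divides2 H (x i) y}"
  have "left_ideal I M"
  proof -
    have "h \<otimes>\<^bsub>H\<^esub> y \<in> I" if hy: "h \<in> K" "y \<in> I" for h y
    proof -
      obtain i where "y \<in> K" "divides2 H (x i) y" using hy(2) by (auto simp: I_def)
      moreover from this have "divides2 H y (h \<otimes>\<^bsub>H\<^esub> y)"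
        using hy(1) K.subset divides2_mult(2) by blast
      ultimately show ?thesis using hy(1) divides2_trans by (auto simp: I_def)
    qed
    then show ?thesis by (auto simp: left_ideal_def M_def set_mult_def I_def)
  qed
  moreover have "carrier M = monoid_generate M ((div_units H \<inter> K) <#>\<^bsub>M\<^esub> A <#>\<^bsub>M\<^esub> (div_units H \<inter> K))"
    using gen by (simp add: M_def monoid_generate_carrier_update set_mult_def)
  ultimately have "fin_gen_left_ideal I M"
    using M.left_duo_fin_gen_left_ideal[of A "div_units H \<inter> K" I] A
      divisor_closed_left_duo[OF assms(2) K(1)] divisor_closed_div_units[OF K(1)]
    by (simp add: M_def)
  then obtain F where F: "finite F" "F \<subseteq> I" "I \<subseteq> K <#>\<^bsub>H\<^esub> F"
    by (auto simp: fin_gen_left_ideal_def M_def set_mult_def)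
  have "\<forall>f\<in>F. \<exists>i. divides2 H (x i) f" using F(2) by (auto simp: I_def)
  then obtain n where n: "\<And>f. f \<in> F \<Longrightarrow> divides2 H (x (n f)) f"
    using bchoice[of F "\<lambda>f i. divides2 H (x i) f"] by blast
  \<comment> \<open>The ideal of \<open>x m\<close> contains all generators in \<open>F\<close>. As
    some \<open>f\<close> in \<open>F\<close> divides \<open>x (Suc m)\<close>, so does
    \<open>x m\<close>, against strictness.\<close>
  obtain m where m: "\<And>f. f \<in> F \<Longrightarrow> n f \<le> m"
    using finite_nat_set_iff_bounded_le[of "n ` F"] F(1) by auto
  have "x (Suc m) \<in> I" using xK divides2_refl[OF x] by (auto simp: I_def)
  then obtain h f where hf: "h \<in> K" "f \<in> F" "x (Suc m) = h \<otimes>\<^bsub>H\<^esub> f"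
    using F(3) by (auto simp: set_mult_def)
  have "divides2 H f (x (Suc m))"
    using divides2_mult(2)[of h f] hf F(2) K.subset by (auto simp: I_def)
  then show False
    using strict'[of m] divides2_trans chain[OF m] n hf(2) by blast
qed

end
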